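(* Let $F$ be a gauge on $\mathbb{R}^2$ that is smooth on $\mathbb{R}^2\setminus\{0\}$ and whose unit circle $S=\{x:F(x)=1\}$ is smooth and strictly convex, with associated gauge $F_a$. Let $\gamma(\tau)=(\gamma_1(\tau),\gamma_2(\tau))$ be an oriented smooth regular curve in $(\mathbb{R}^2,F)$ with arbitrary parameter $\tau$, let $'$ denote $d/d\tau$, and let $k_c$ be the circular curvature of $\gamma$. With $(F_a)_{x_i}=\partial F_a/\partial x_i$: (i) If $\gamma_1'\neq 0$, then $$k_c=\frac{((F_a)_{x_2}(\gamma_1',\gamma_2'))'}{\gamma_1'}.$$ (ii) If $\gamma_2'\neq 0$, then $$k_c=-\frac{((F_a)_{x_1}(\gamma_1',\gamma_2'))'}{\gamma_2'}.$$
   Context: A gauge on $\mathbb{R}^2$ is a function $F:\mathbb{R}^2\to\mathbb{R}$ with $F(x)\ge 0$, $F(x)=0\Leftrightarrow x=0$; $F(\lambda x)=\lambda F(x)$ for $\lambda>0$; $F(x+y)\le F(x)+F(y)$ (no symmetry assumed). For $x=(x_1,x_2)$, $y=(y_1,y_2)$ put $[x,y]=x_1y_2-x_2y_1$. The associated gauge is $F_a(x)=\sup\{[y,x]:F(y)=1\}$. Circular curvature: let $s$ be the arc-length parameter of $\gamma$ with respect to $F$, $ds/d\tau=F(\gamma'(\tau))$, so $F(d\gamma/ds)=1$. Let $\varphi(t)$ be a counter-clockwise parametrization of $S$ by $F$-arc length, $F(\varphi'(t))=1$. Write $\frac{d\gamma}{ds}(s)=\varphi'(t(s))$, where here $\varphi'$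 denotes $d\varphi/dt$. Then $k_c:=dt/ds$, evaluated at the corresponding point of the curve. *)

theory Defs
  imports "HOL-Analysis.Analysis"
begin

definition plane_gauge :: "(real^2 \<Rightarrow> real) \<Rightarrow> bool" where
  "plane_gauge F \<longleftrightarrow>
     (\<forall>x. 0 \<le> F x) \<and> (\<forall>x. F x = 0 \<longleftrightarrow> x = 0) \<and>
     (\<forall>c x. 0 < c \<longrightarrow> F (c *\<^sub>R x) = c * F x) \<and>
     (\<forall>x y. F (x + y) \<le> F x + F y)"

definition unit_circle :: "(real^2 \<Rightarrow> real) \<Rightarrow> (real^2) set" where
  "unit_circle F = {x. F x = 1}"

definition bracket :: "real^2 \<Rightarrow> real^2 \<Rightarrow> real" where
  "bracket x y = x$1 * y$2 - x$2 * y$1"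

definition associated_gauge :: "(real^2 \<Rightarrow> real) \<Rightarrow> real^2 \<Rightarrow> real" where
  "associated_gauge F x = (SUP y\<in>unit_circle F. bracket y x)"

definition partial_derivative :: "2 \<Rightarrow> (real^2 \<Rightarrow> real) \<Rightarrow> real^2 \<Rightarrow> real" where
  "partial_derivative i f x = deriv (\<lambda>h. f (x + h *\<^sub>R axis i 1)) 0"

(* Meant for open U: f is k times continuously differentiable on U. *)
primrec Ck_on :: "nat \<Rightarrow> 'a::euclidean_space set \<Rightarrow> ('a \<Rightarrow> 'b::real_normed_vector) \<Rightarrow> bool" where
  "Ck_on 0 U f \<longleftrightarrow> continuous_on U f"
| "Ck_on (Suc k) U f \<longleftrightarrow>
     (\<forall>x\<in>U. f differentiable (at x)) \<and>
     (\<forall>v. Ck_on k U (\<lambda>x. frechet_derivative f (at x) v))"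

definition smooth_on :: "'a::euclidean_space set \<Rightarrow> ('a \<Rightarrow> 'b::real_normed_vector) \<Rightarrow> bool" where
  "smooth_on U f \<longleftrightarrow> (\<forall>k. Ck_on k U f)"

(* An embedded smooth curve: locally the zero set of a smooth submersion. *)
definition smooth_curve_set :: "(real^2) set \<Rightarrow> bool" where
  "smooth_curve_set S \<longleftrightarrow>
     (\<forall>p\<in>S. \<exists>U (g :: real^2 \<Rightarrow> real). open U \<and> p \<in> U \<and> smooth_on U g \<and>
        (\<forall>x\<in>U. frechet_derivative g (at x) \<noteq> (\<lambda>_. 0)) \<and>
        S \<inter> U = {x\<in>U. g x = 0})"

(* For the boundary S of a convex body: no chord of S meets S in its interior.
   Positive curvature of S is not required. *)
definition strictly_convex_curve :: "(real^2) set \<Rightarrow> bool" where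
  "strictly_convex_curve S \<longleftrightarrow>
     (\<forall>x\<in>S. \<forall>y\<in>S. open_segment x y \<inter> S = {})"

definition regular_curve_on :: "real set \<Rightarrow> (real \<Rightarrow> real^2) \<Rightarrow> bool" where
  "regular_curve_on I \<gamma> \<longleftrightarrow>
     smooth_on I \<gamma> \<and> (\<forall>\<tau>\<in>I. vector_derivative \<gamma> (at \<tau>) \<noteq> 0)"

definition arc_length_parameter ::
    "(real^2 \<Rightarrow> real) \<Rightarrow> real set \<Rightarrow> (real \<Rightarrow> real^2) \<Rightarrow> (real \<Rightarrow> real) \<Rightarrow> bool" where
  "arc_length_parameter F I \<gamma> s \<longleftrightarrow>
     (\<forall>\<tau>\<in>I. (s has_real_derivative F (vector_derivative \<gamma> (at \<tau>))) (at \<tau>))"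

(* The circle is parametrized (periodically) over the whole real line; since 0 lies inside it,
   counter-clockwise means that position and velocity form a positive basis. *)
definition ccw_arc_length_parametrization ::
    "(real^2 \<Rightarrow> real) \<Rightarrow> (real \<Rightarrow> real^2) \<Rightarrow> bool" where
  "ccw_arc_length_parametrization F \<phi> \<longleftrightarrow>
     smooth_on UNIV \<phi> \<and> range \<phi> = unit_circle F \<and>
     (\<forall>t. F (vector_derivative \<phi> (at t)) = 1 \<and>
          0 < bracket (\<phi> t) (vector_derivative \<phi> (at t)))"

(* k = dt/ds at the point \<gamma> \<tau>.  Here \<Gamma> is \<gamma> reparametrized by arc length s, and t is a function
   of s with d\<Gamma>/ds = \<phi>'(t(s)).  This is a relation because dt/ds need not exist where
   the circle has vanishing curvature. *)
definition has_circular_curvature ::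
    "(real^2 \<Rightarrow> real) \<Rightarrow> real set \<Rightarrow> (real \<Rightarrow> real^2) \<Rightarrow> real \<Rightarrow> real \<Rightarrow> bool" where
  "has_circular_curvature F I \<gamma> \<tau> k \<longleftrightarrow>
     (\<exists>s \<Gamma> \<phi> t.
        arc_length_parameter F I \<gamma> s \<and>
        (\<forall>u\<in>I. \<Gamma> (s u) = \<gamma> u) \<and>
        ccw_arc_length_parametrization F \<phi> \<and>
        (\<forall>\<sigma>\<in>s ` I. (\<Gamma> has_vector_derivative vector_derivative \<phi> (at (t \<sigma>))) (at \<sigma>)) \<and>
        (t has_real_derivative k) (at (s \<tau>)))"

end

theory Submission
  imports Defs
begin

text \<open>
  The value of the associated gauge at \<open>x\<close> is the maximum over the unit circle of the linear form
  \<open>y \<mapsto> [y,x]\<close>. In the direction \<open>x = c \<phi>'(t)\<close> with \<open>c > 0\<close> the unique maximizer is \<open>\<phi>(t)\<close>: the tangent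
  at \<open>\<phi>(t)\<close> is a supporting line because \<open>F\<close> is convex, and it has only one contact point by strict
  convexity. A support function is differentiable wherever its maximizer is unique, and the maximizer
  is its gradient. Hence the gradient of \<open>F\<^sub>a\<close> at \<open>\<gamma>'(\<tau>) = F(\<gamma>'(\<tau>)) \<phi>'(t(s(\<tau>)))\<close> is
  \<open>(- \<phi>\<^sub>2, \<phi>\<^sub>1)\<close> taken at \<open>t(s(\<tau>))\<close>, and the chain rule gives \<open>(\<phi>(t(s(\<tau>))))' = k\<^sub>c \<gamma>'(\<tau>)\<close>.
\<close>

section \<open>Support functions of compact sets\<close>

text \<open>The error of the linear approximation is nonnegative, by testing the supremum with
  \<open>p\<close>. It is at most \<open>norm (y - p) * norm h\<close> for a maximizer
  \<open>y\<close> at \<open>x + h\<close>, and compactness forces \<open>y\<close> towards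
  \<open>p\<close> as \<open>h\<close> tends to 0.\<close>

lemma support_function_has_derivative:
  fixes S :: "'a::euclidean_space set"
  assumes S: "compact S" and p: "p \<in> S"
    and unique: "\<And>y. y \<in> S \<Longrightarrow> y \<noteq> p \<Longrightarrow> y \<bullet> x < p \<bullet> x"
  shows "((\<lambda>x. SUP y\<in>S. y \<bullet> x) has_derivative (\<lambda>h. p \<bullet> h)) (at x)"
proof -
  define f where "f = (\<lambda>x. SUP y\<in>S. y \<bullet> x)"
  have ub: "y \<bullet> z \<le> f z" if "y \<in> S" for y z
  proof -
    have "compact ((\<lambda>y. y \<bullet> z) ` S)"
      by (intro compact_continuous_image continuous_intros S)
    then have "bdd_above ((\<lambda>y. y \<bullet> z) ` S)"
      by (simp add: bounded_imp_bdd_above compact_imp_bounded)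
    then show ?thesis
      unfolding f_def by (rule cSUP_upper[OF that])
  qed
  have attained: "\<exists>y\<in>S. f z = y \<bullet> z" for z
  proof -
    have "continuous_on S (\<lambda>y. y \<bullet> z)"
      by (intro continuous_intros)
    then obtain y where "y \<in> S" "\<forall>w\<in>S. w \<bullet> z \<le> y \<bullet> z"
      using continuous_attains_sup[OF S] p by blast
    then have "f z = y \<bullet> z"
      unfolding f_def by (intro cSup_eq_maximum) auto
    with \<open>y \<in> S\<close> show ?thesis by blast
  qed
  have fx: "f x = p \<bullet> x"
    using attained[of x] ub[OF p, of x] unique by fastforce
  have lower: "0 \<le> f (x + h) - f x - p \<bullet> h" for h
    using ub[OF p, of "x + h"] fx by (simp add: inner_add_right)
  have "\<exists>d>0. \<forall>h. norm h < d \<longrightarrow> norm (f (x + h) - f x - p \<bullet> h) \<le> e * norm h" if e: "e > 0" for e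
  proof -
    define K where "K = S - ball p e"
    have "compact K"
      unfolding K_def using S by (simp add: compact_diff)
    \<comment> \<open>Away from \<open>p\<close> the form stays below its maximum by a uniform gap,
      by compactness; if \<open>K\<close> is empty any positive gap serves, here 1.\<close>
    have "\<exists>\<delta>>0. \<forall>y\<in>K. y \<bullet> x \<le> p \<bullet> x - \<delta>"
    proof (cases "K = {}")
      case False
      have "continuous_on K (\<lambda>y. y \<bullet> x)"
        by (intro continuous_intros)
      then obtain w where w: "w \<in> K" "\<forall>y\<in>K. y \<bullet> x \<le> w \<bullet> x"
        using continuous_attains_sup[OF \<open>compact K\<close> False] by blast
      then have "w \<bullet> x < p \<bullet> x"
        using unique[of w] e by (cases "w = p") (auto simp: K_def)
      then show ?thesis
        using w by (intro exI[of _ "p \<bullet> x - w \<bullet> x"]) auto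
    qed (auto intro: exI[of _ 1])
    then obtain \<delta> where \<delta>: "\<delta> > 0" "\<And>y. y \<in> K \<Longrightarrow> y \<bullet> x \<le> p \<bullet> x - \<delta>"
      by blast
    obtain R where R: "R > 0" "\<And>y. y \<in> S \<Longrightarrow> norm y \<le> R"
      using compact_imp_bounded[OF S] by (meson bounded_pos)
    \<comment> \<open>Two points of \<open>S\<close> are at most \<open>2 * R\<close> apart, so for
      such \<open>h\<close> a maximizer \<open>y\<close> at \<open>x + h\<close> loses less than
      \<delta> at \<open>x\<close> and cannot lie in \<open>K\<close>.\<close>
    have "norm (f (x + h) - f x - p \<bullet> h) \<le> e * norm h" if h: "norm h < \<delta> / (2 * R)" for h
    proof -
      obtain y where y: "y \<in> S" "f (x + h) = y \<bullet> (x + h)"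
        using attained by blast
      have "p \<bullet> x - y \<bullet> x \<le> (y - p) \<bullet> h"
        using ub[OF p, of "x + h"] y by (simp add: inner_add_right inner_diff_left)
      also have "\<dots> \<le> norm (y - p) * norm h"
        by (rule norm_cauchy_schwarz)
      also have "\<dots> \<le> (2 * R) * norm h"
        using R(2)[OF y(1)] R(2)[OF p] norm_triangle_ineq4[of y p] by (intro mult_right_mono) auto
      also have "\<dots> < \<delta>"
        using h R by (simp add: field_simps)
      finally have "y \<notin> K"
        using \<delta>(2)[of y] by force
      then have "norm (y - p) < e"
        using y by (simp add: K_def dist_norm norm_minus_commute)
      have "f (x + h) - f x - p \<bullet> h \<le> (y - p) \<bullet> h"
        using y fx ub[OF y(1), of x] by (simp add: inner_add_right inner_diff_left)
      also have "\<dots> \<le> norm (y - p) * norm h"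
        by (rule norm_cauchy_schwarz)
      also have "\<dots> \<le> e * norm h"
        using \<open>norm (y - p) < e\<close> by (intro mult_right_mono) auto
      finally show ?thesis
        using lower[of h] by simp
    qed
    then show ?thesis
      using \<delta> R by (intro exI[of _ "\<delta> / (2 * R)"]) auto
  qed
  then have "(f has_derivative (\<lambda>h. p \<bullet> h)) (at x)"
    unfolding has_derivative_at_alt
    by (metis (no_types, lifting) add.commute bounded_linear_inner_right diff_add_cancel)
  then show ?thesis
    by (simp add: f_def)
qed

section \<open>Gauges and their unit circles\<close>

lemma plane_gauge_pos_iff: "plane_gauge F \<Longrightarrow> 0 < F x \<longleftrightarrow> x \<noteq> 0"
  by (auto simp: plane_gauge_def order_less_le)

lemma plane_gauge_convex_on:
  assumes "plane_gauge F"
  shows "convex_on UNIV F"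
proof (rule convex_onI)
  fix t :: real and x y
  assume "0 < t" "t < 1"
  then show "F ((1 - t) *\<^sub>R x + t *\<^sub>R y) \<le> (1 - t) * F x + t * F y"
    using assms unfolding plane_gauge_def by (metis diff_gt_0_iff_gt)
qed simp

text \<open>Convexity in finite dimension gives continuity, hence closedness. Boundedness comes from
  the positive minimum \<open>F w\<close> on the Euclidean unit sphere, by homogeneity.\<close>

lemma compact_unit_circle:
  assumes F: "plane_gauge F"
  shows "compact (unit_circle F)"
proof -
  have cont: "continuous_on A F" for A
    using convex_on_continuous[OF open_UNIV plane_gauge_convex_on[OF F]] continuous_on_subset by blast
  have "sphere (0::real^2) 1 \<noteq> {}"
    by simp
  then obtain w :: "real^2" where w: "norm w = 1" "\<And>x. norm x = 1 \<Longrightarrow> F w \<le> F x"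
    using continuous_attains_inf[OF compact_sphere _ cont, of 0 1] by auto
  have "F w > 0"
    using plane_gauge_pos_iff[OF F] w(1) by force
  have "norm x \<le> 1 / F w" if x: "F x = 1" for x
  proof -
    have "x \<noteq> 0"
      using plane_gauge_pos_iff[OF F, of x] x by simp
    then have "F w \<le> F (inverse (norm x) *\<^sub>R x)"
      by (intro w(2)) simp
    also have "\<dots> = inverse (norm x)"
      using F \<open>x \<noteq> 0\<close> x unfolding plane_gauge_def by simp
    finally show ?thesis
      using \<open>F w > 0\<close> \<open>x \<noteq> 0\<close> by (simp add: field_simps)
  qed
  then have "bounded (unit_circle F)"
    unfolding bounded_iff unit_circle_def by blast
  moreover have "closed (unit_circle F)"
    unfolding unit_circle_def using cont by (intro closed_Collect_eq) auto
  ultimately show ?thesis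
    by (simp add: compact_eq_bounded_closed)
qed

section \<open>The gradient of the associated gauge\<close>

text \<open>The clockwise quarter turn makes \<open>bracket\<close> an inner product, so the
  associated gauge is a support function composed with a rotation.\<close>

definition rotate_cw :: "real^2 \<Rightarrow> real^2" where
  "rotate_cw x = vector [x$2, - x$1]"

lemma bracket_eq_inner_rotate_cw: "bracket y x = y \<bullet> rotate_cw x"
  by (simp add: bracket_def rotate_cw_def inner_vec_def sum_2)

lemma bounded_linear_rotate_cw: "bounded_linear rotate_cw"
  by (intro linear_conv_bounded_linear[THEN iffD1] linearI)
     (simp_all add: rotate_cw_def vec_eq_iff forall_2)

lemma smooth_on_differentiable:
  assumes "smooth_on U f" "x \<in> U"
  shows "f differentiable (at x)"
proof -
  have "Ck_on (Suc 0) U f"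
    using assms(1) unfolding smooth_on_def by blast
  with assms(2) show ?thesis
    by simp
qed

text \<open>\<open>F'\<close> is a supporting functional at \<open>p\<close>, and
  \<open>F' v = 0\<close> makes it proportional to the bracket with \<open>v\<close> in the second
  slot. So \<open>p\<close> maximizes this form, uniquely by strict convexity, and the factor
  \<open>c > 0\<close> does not move the maximizer.\<close>

lemma associated_gauge_has_derivative:
  assumes F: "plane_gauge F" and S: "strictly_convex_curve (unit_circle F)"
    and p: "F p = 1" and vp: "0 < bracket p v"
    and tangent: "(F has_derivative F') (at p)" "F' v = 0"
    and c: "c > 0"
  shows "(associated_gauge F has_derivative bracket p) (at (c *\<^sub>R v))"
proof -
  have hom: "F (a *\<^sub>R x) = a * F x" if "a > 0" for a x
    using F that by (simp add: plane_gauge_def)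
  have linear: "linear F'"
    using tangent(1) has_derivative_linear by blast
  \<comment> \<open>Gradient inequality: by convexity the difference quotients from \<open>p\<close>
    towards \<open>y\<close> are at most \<open>F y - F p\<close>; the step then tends to 0 from the
    right.\<close>
  have convex: "F' (y - p) \<le> F y - F p" for y
  proof -
    have "((\<lambda>h. F (p + h *\<^sub>R (y - p))) has_derivative (\<lambda>h. F' (h *\<^sub>R (y - p)))) (at 0)"
      by (rule has_derivative_compose[of "\<lambda>h. p + h *\<^sub>R (y - p)" _ "0::real" UNIV F F'])
         (use tangent(1) in \<open>auto intro!: derivative_eq_intros\<close>)
    then have "((\<lambda>h. F (p + h *\<^sub>R (y - p))) has_real_derivative F' (y - p)) (at 0)"
      by (rule has_derivative_imp_has_field_derivative) (simp add: linear_cmul[OF linear])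
    then have lim: "((\<lambda>h. (F (p + h *\<^sub>R (y - p)) - F p) / h) \<longlongrightarrow> F' (y - p)) (at_right 0)"
      by (auto simp: DERIV_def intro: tendsto_mono[OF at_le])
    have "(F (p + h *\<^sub>R (y - p)) - F p) / h \<le> F y - F p" if "0 < h" "h < 1" for h
    proof -
      have "F (p + h *\<^sub>R (y - p)) = F ((1 - h) *\<^sub>R p + h *\<^sub>R y)"
        by (simp add: algebra_simps)
      also have "\<dots> \<le> (1 - h) * F p + h * F y"
        using convex_onD[OF plane_gauge_convex_on[OF F], of h p y] that by simp
      finally show ?thesis
        using that by (simp add: field_simps)
    qed
    then have "\<forall>\<^sub>F h in at_right 0. (F (p + h *\<^sub>R (y - p)) - F p) / h \<le> F y - F p"
      unfolding eventually_at_right_field using zero_less_one by blast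
    from tendsto_upperbound[OF lim this] show ?thesis
      by simp
  qed
  \<comment> \<open>Since \<open>F' p = 1\<close> and \<open>F' v = 0\<close>, the form \<open>F'\<close> is \<open>[\<cdot>,v] / [p,v]\<close>.\<close>
  have F'p: "F' p = 1"
    \<comment> \<open>Scaling \<open>p\<close> by 2 and by 1/2 in the gradient inequality bounds
      \<open>F' p\<close> by 1 from above and from below.\<close>
    using convex[of "2 *\<^sub>R p"] convex[of "(1/2) *\<^sub>R p"] hom[of 2 p] hom[of "1/2" p] p
    by (simp add: linear_diff[OF linear] linear_cmul[OF linear])
  \<comment> \<open>Cramer's rule for the basis \<open>p\<close>, \<open>v\<close>.\<close>
  have decomp: "bracket p v *\<^sub>R y = bracket y v *\<^sub>R p + bracket p y *\<^sub>R v" for y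
    by (simp add: bracket_def vec_eq_iff forall_2 algebra_simps)
  have F'eq: "bracket p v * F' y = bracket y v" for y
    using arg_cong[OF decomp[of y], of F'] tangent(2) F'p
    by (simp add: linear_add[OF linear] linear_cmul[OF linear])
  have max: "bracket y v \<le> bracket p v" if "F y = 1" for y
  proof -
    have "F' y \<le> 1"
      using convex[of y] that p F'p by (simp add: linear_diff[OF linear])
    then show ?thesis
      using F'eq[of y] vp by (metis mult.right_neutral mult_left_mono less_eq_real_def)
  qed
  have unique: "bracket y v < bracket p v" if y: "F y = 1" "y \<noteq> p" for y
  proof (rule ccontr)
    assume "\<not> bracket y v < bracket p v"
    with max[OF y(1)] have eq: "bracket y v = bracket p v"
      by simp
    \<comment> \<open>The midpoint of a second maximizer and \<open>p\<close> is a maximizing point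
      too. Convexity gives \<open>F m <= 1\<close>; rescaling \<open>m\<close> onto the circle and
      comparing with the maximum gives \<open>F m >= 1\<close>. So the open chord would meet the
      circle.\<close>
    define m where "m = (1 - 1/2) *\<^sub>R y + (1/2::real) *\<^sub>R p"
    have m: "bracket m v = bracket p v"
      using eq by (simp add: m_def bracket_def algebra_simps)
    have "F m \<le> 1"
      using convex_onD[OF plane_gauge_convex_on[OF F], of "1/2" y p] y p by (simp add: m_def)
    have "m \<noteq> 0"
      using m vp by (auto simp: bracket_def)
    then have "F m > 0"
      using plane_gauge_pos_iff[OF F] by blast
    then have "F (inverse (F m) *\<^sub>R m) = 1"
      by (simp add: hom)
    from max[OF this] have "inverse (F m) * bracket m v \<le> bracket p v"
      by (simp add: bracket_def algebra_simps)
    then have "F m \<ge> 1"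
      using m vp \<open>F m > 0\<close> by (simp add: field_simps)
    with \<open>F m \<le> 1\<close> have "m \<in> unit_circle F"
      by (simp add: unit_circle_def)
    moreover have "m \<in> open_segment y p"
      unfolding m_def in_segment using y by (intro conjI exI[of _ "1/2"]) auto
    ultimately show False
      using S y p unfolding strictly_convex_curve_def unit_circle_def by blast
  qed
  have cv: "bracket y (c *\<^sub>R v) = c * bracket y v" for y
    by (simp add: bracket_def algebra_simps)
  have "((\<lambda>x. SUP y\<in>unit_circle F. y \<bullet> x) has_derivative (\<lambda>h. p \<bullet> h)) (at (rotate_cw (c *\<^sub>R v)))"
    using p unique c cv
    by (intro support_function_has_derivative compact_unit_circle[OF F])
       (auto simp: unit_circle_def simp flip: bracket_eq_inner_rotate_cw)
  from has_derivative_compose[OF bounded_linear_imp_has_derivative[OF bounded_linear_rotate_cw] this]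
  show ?thesis
    by (simp add: associated_gauge_def[abs_def] bracket_eq_inner_rotate_cw[abs_def])
qed

lemma partial_derivative_eq:
  assumes "(f has_derivative f') (at x)"
  shows "partial_derivative i f x = f' (axis i 1)"
proof -
  have "((\<lambda>h. f (x + h *\<^sub>R axis i 1)) has_derivative (\<lambda>h. f' (h *\<^sub>R axis i 1))) (at 0)"
    by (rule has_derivative_compose[of "\<lambda>h. x + h *\<^sub>R axis i 1" _ "0::real" UNIV f f'])
       (use assms in \<open>auto intro!: derivative_eq_intros\<close>)
  then have "((\<lambda>h. f (x + h *\<^sub>R axis i 1)) has_real_derivative f' (axis i 1)) (at 0)"
    by (rule has_derivative_imp_has_field_derivative)
       (simp add: linear_cmul[OF has_derivative_linear[OF assms]])
  then show ?thesis
    by (simp add: partial_derivative_def DERIV_imp_deriv)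
qed

text \<open>Differentiating \<open>F (\<phi> u) = 1\<close> puts the velocity of the circle in the
  kernel of the derivative of \<open>F\<close>; the counter-clockwise orientation makes the bracket
  of position and velocity positive.\<close>

lemma associated_gauge_has_derivative_circle:
  assumes F: "plane_gauge F" "smooth_on (- {0}) F" "strictly_convex_curve (unit_circle F)"
    and \<phi>: "ccw_arc_length_parametrization F \<phi>" and c: "c > 0"
  shows "(associated_gauge F has_derivative bracket (\<phi> t))
           (at (c *\<^sub>R vector_derivative \<phi> (at t)))"
proof -
  have circle: "F (\<phi> u) = 1" for u
    using \<phi> unfolding ccw_arc_length_parametrization_def unit_circle_def by auto
  have "\<phi> t \<noteq> 0"
    using circle[of t] plane_gauge_pos_iff[OF F(1), of "\<phi> t"] by simp
  then obtain F' where F': "(F has_derivative F') (at (\<phi> t))"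
    using smooth_on_differentiable[OF F(2), of "\<phi> t"] by (auto simp: differentiable_def)
  have "\<phi> differentiable (at t)"
    using \<phi> smooth_on_differentiable unfolding ccw_arc_length_parametrization_def by blast
  then have "(\<phi> has_vector_derivative vector_derivative \<phi> (at t)) (at t)"
    by (simp add: vector_derivative_works)
  then have "((\<lambda>u. F (\<phi> u)) has_derivative (\<lambda>h. F' (h *\<^sub>R vector_derivative \<phi> (at t)))) (at t)"
    unfolding has_vector_derivative_def by (rule has_derivative_compose[where f = \<phi> and g = F, OF _ F'])
  moreover have "((\<lambda>u. F (\<phi> u)) has_derivative (\<lambda>h. 0)) (at t)"
    by (simp add: circle)
  ultimately have "F' (1 *\<^sub>R vector_derivative \<phi> (at t)) = 0"
    by (metis has_derivative_unique)
  then show ?thesis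
    using \<phi> circle c unfolding ccw_arc_length_parametrization_def
    by (intro associated_gauge_has_derivative[OF F(1,3) _ _ F']) auto
qed

section \<open>The curvature formulas\<close>

text \<open>The differentiability claims accompany the formulas because \<open>deriv\<close> and
  \<open>partial_derivative\<close> are total and would otherwise return arbitrary values.\<close>

theorem corollary3p2:
  fixes F :: "real^2 \<Rightarrow> real" and \<gamma> :: "real \<Rightarrow> real^2" and I :: "real set" and \<tau> k\<^sub>c :: real
  assumes gauge: "plane_gauge F"
    and smooth: "smooth_on (- {0}) F"
    and smooth_circle: "smooth_curve_set (unit_circle F)"
    and strictly_convex: "strictly_convex_curve (unit_circle F)"
    and interval: "open I" "is_interval I"
    and curve: "regular_curve_on I \<gamma>"
    and point: "\<tau> \<in> I"
    and curvature: "has_circular_curvature F I \<gamma> \<tau> k\<^sub>c"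
  defines "d\<gamma> \<equiv> \<lambda>u. vector_derivative \<gamma> (at u)"
    and "Fa\<^sub>1 \<equiv> partial_derivative 1 (associated_gauge F)"
    and "Fa\<^sub>2 \<equiv> partial_derivative 2 (associated_gauge F)"
  shows "(\<forall>u\<in>I. associated_gauge F differentiable (at (d\<gamma> u))) \<and>
         (d\<gamma> \<tau> $ 1 \<noteq> 0 \<longrightarrow>
           (\<lambda>u. Fa\<^sub>2 (d\<gamma> u)) differentiable (at \<tau>) \<and>
           k\<^sub>c = deriv (\<lambda>u. Fa\<^sub>2 (d\<gamma> u)) \<tau> / d\<gamma> \<tau> $ 1) \<and>
         (d\<gamma> \<tau> $ 2 \<noteq> 0 \<longrightarrow>
           (\<lambda>u. Fa\<^sub>1 (d\<gamma> u)) differentiable (at \<tau>) \<and>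
           k\<^sub>c = - (deriv (\<lambda>u. Fa\<^sub>1 (d\<gamma> u)) \<tau> / d\<gamma> \<tau> $ 2))"
proof -
  obtain s \<Gamma> \<phi> t where
    s: "arc_length_parameter F I \<gamma> s" and
    \<Gamma>: "\<And>u. u \<in> I \<Longrightarrow> \<Gamma> (s u) = \<gamma> u" and
    \<phi>: "ccw_arc_length_parametrization F \<phi>" and
    d\<Gamma>: "\<And>\<sigma>. \<sigma> \<in> s ` I \<Longrightarrow>
            (\<Gamma> has_vector_derivative vector_derivative \<phi> (at (t \<sigma>))) (at \<sigma>)" and
    t: "(t has_real_derivative k\<^sub>c) (at (s \<tau>))"
    using curvature unfolding has_circular_curvature_def by blast
  have ds: "(s has_real_derivative F (d\<gamma> u)) (at u)" if "u \<in> I" for u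
    using s that by (simp add: arc_length_parameter_def d\<gamma>_def)
  have F_pos: "F (d\<gamma> u) > 0" if "u \<in> I" for u
    using curve that by (simp add: plane_gauge_pos_iff[OF gauge] regular_curve_on_def d\<gamma>_def)
  \<comment> \<open>Chain rule for \<gamma> as \<Gamma> after \<open>s\<close>: each velocity is a
    positive multiple of a velocity of the circle.\<close>
  have d\<gamma>: "d\<gamma> u = F (d\<gamma> u) *\<^sub>R vector_derivative \<phi> (at (t (s u)))" if u: "u \<in> I" for u
  proof -
    have "(\<Gamma> \<circ> s has_vector_derivative F (d\<gamma> u) *\<^sub>R vector_derivative \<phi> (at (t (s u)))) (at u)"
      by (rule vector_diff_chain_at)
         (use ds[OF u] d\<Gamma> u in \<open>auto simp: has_real_derivative_iff_has_vector_derivative\<close>)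
    then have "(\<gamma> has_vector_derivative F (d\<gamma> u) *\<^sub>R vector_derivative \<phi> (at (t (s u)))) (at u)"
      by (rule has_vector_derivative_transform_within_open[OF _ interval(1) u]) (simp add: \<Gamma>)
    from vector_derivative_at[OF this] show ?thesis
      unfolding d\<gamma>_def .
  qed
  have dFa: "(associated_gauge F has_derivative bracket (\<phi> (t (s u)))) (at (d\<gamma> u))" if "u \<in> I" for u
    using associated_gauge_has_derivative_circle
      [OF gauge smooth strictly_convex \<phi> F_pos[OF that], of "t (s u)"] d\<gamma>[OF that] by simp
  have Fa: "Fa\<^sub>2 (d\<gamma> u) = \<phi> (t (s u)) $ 1" "Fa\<^sub>1 (d\<gamma> u) = - (\<phi> (t (s u)) $ 2)" if "u \<in> I" for u
    unfolding Fa\<^sub>1_def Fa\<^sub>2_def partial_derivative_eq[OF dFa[OF that]]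
    by (simp_all add: bracket_def axis_def)
  have "\<phi> differentiable (at (t (s \<tau>)))"
    using \<phi> smooth_on_differentiable unfolding ccw_arc_length_parametrization_def by blast
  then have "(\<phi> has_vector_derivative vector_derivative \<phi> (at (t (s \<tau>)))) (at (t (s \<tau>)))"
    by (simp add: vector_derivative_works)
  moreover have "((\<lambda>u. t (s u)) has_vector_derivative k\<^sub>c * F (d\<gamma> \<tau>)) (at \<tau>)"
    using DERIV_chain2[OF t ds[OF point]] by (simp add: has_real_derivative_iff_has_vector_derivative)
  ultimately have "((\<lambda>u. \<phi> (t (s u))) has_vector_derivative
      (k\<^sub>c * F (d\<gamma> \<tau>)) *\<^sub>R vector_derivative \<phi> (at (t (s \<tau>)))) (at \<tau>)"
    using vector_diff_chain_at[of "\<lambda>u. t (s u)" _ \<tau> \<phi>] by (simp add: o_def)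
  \<comment> \<open>The speed contributed by \<open>s\<close> turns the unit velocity of the circle
    back into the velocity of \<gamma>.\<close>
  also have "(k\<^sub>c * F (d\<gamma> \<tau>)) *\<^sub>R vector_derivative \<phi> (at (t (s \<tau>))) = k\<^sub>c *\<^sub>R d\<gamma> \<tau>"
    using arg_cong[OF d\<gamma>[OF point], of "scaleR k\<^sub>c"] by simp
  finally have d\<phi>: "((\<lambda>u. \<phi> (t (s u)) $ i) has_real_derivative k\<^sub>c * d\<gamma> \<tau> $ i) (at \<tau>)" for i
    using bounded_linear.has_vector_derivative[OF bounded_linear_vec_nth, of _ "k\<^sub>c *\<^sub>R d\<gamma> \<tau>"]
    by (simp add: has_real_derivative_iff_has_vector_derivative)
  \<comment> \<open>The identities \<open>Fa\<close> are known on \<open>I\<close> only, which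
    suffices for derivatives at \<tau> since \<open>I\<close> is open.\<close>
  have D2: "((\<lambda>u. Fa\<^sub>2 (d\<gamma> u)) has_real_derivative k\<^sub>c * d\<gamma> \<tau> $ 1) (at \<tau>)"
    by (rule has_field_derivative_transform_within_open[OF d\<phi> interval(1) point]) (simp add: Fa)
  have D1: "((\<lambda>u. Fa\<^sub>1 (d\<gamma> u)) has_real_derivative - (k\<^sub>c * d\<gamma> \<tau> $ 2)) (at \<tau>)"
    by (rule has_field_derivative_transform_within_open
          [OF DERIV_minus[OF d\<phi>] interval(1) point]) (simp add: Fa)
  have diff: "\<forall>u\<in>I. associated_gauge F differentiable (at (d\<gamma> u))"
    using dFa unfolding differentiable_def by blast
  have "(\<lambda>u. Fa\<^sub>1 (d\<gamma> u)) differentiable (at \<tau>)" "(\<lambda>u. Fa\<^sub>2 (d\<gamma> u)) differentiable (at \<tau>)"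
    using D1 D2 real_differentiable_def by blast+
  with diff show ?thesis
    unfolding DERIV_imp_deriv[OF D1] DERIV_imp_deriv[OF D2] by simp
qed

end
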